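(* Suppose the problem $\mathscr{P}_{MoDR}(x_t)$ is feasible with state $x_t\in\mathbb{R}^n$, and let $(s_{0|t}^*,v_{0|t}^*,\dots,v_{N-1|t}^* )$ be an optimal solution. Apply the input $u_t=K(x_t-s_{0|t}^* )+v_{0|t}^*$. Then for every disturbance value $w(x_t)\in\mathbb{W}$, the problem $\mathscr{P}_{MoDR}(x_{t+1})$ with successor state $x_{t+1}=Ax_t+Bu_t+w(x_t)$ is feasible.
   Context: Superscript $(\tau)$ denotes the $\tau$-th component of a vector, $[a,b]$ for vectors is the set of $x$ with $a\le x\le b$ componentwise, $\|x\|_M^2=x^\top Mx$, and $\mathcal{A}\ominus\mathcal{B}=\{a: a+b\in\mathcal{A}\ \forall b\in\mathcal{B}\}$ is the Pontryagin difference. System: $x_{k+1}=Ax_k+Bu_k+w(x_k)$ with $A\in\mathbb{R}^{n\times n}$, $B\in\mathbb{R}^{n\times m}$, $(A,B)$ stabilizable; the disturbance $w(\cdot)$ takes values in the box $\mathbb{W}=[\tilde w_1,\tilde w_2]\subset\mathbb{R}^n$. State set $\mathbb{X}=[\tilde x_1,\tilde x_2]\subset\mathbb{R}^n$ and input set $\mathbb{U}=\{u\in\mathbb{R}^m: H_uu\le h_u\}$ are compact and contain the origin in their interiors. $K\in\mathbb{R}^{m\times n}$ is a fixed gain such that $A+BK$ is Schur stable. $\varepsilon\in(0,1)$ is a tolerance level and $N$ (a positive integer) is the horizon. $\mathcal{Z}$ is the minimal robust positively invariant set of the error dynamics $e_{k+1}=(A+BK)e_k+w$, $w\in\mathbb{W}$: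 the smallest nonempty compact set with $(A+BK)\mathcal{Z}+\mathbb{W}\subseteq\mathcal{Z}$. The terminal set is $$\mathcal{X}_f=\{s\in\mathbb{R}^n: (A+BK)^is\in\mathbb{X}\ominus\mathcal{Z},\ K(A+BK)^is\in\mathbb{U}\ominus K\mathcal{Z}\ \ \forall i\in\mathbb{N}\},\quad 0\in\mathbb{N}.$$ Mixture model: for each coordinate $\tau$ and each state $x$ one is given a finite mixture with $M_\tau=M_\tau(x)$ components, means $\mu_{\tau,j}(x)\in\mathbb{R}$, variances $\Sigma_{\tau,j}(x)\ge0$, and weights $\gamma_{\tau,j}(x)>0$ summing to one. Tightening parameters: for $i\in\{1,2\}$ and $\tau\in\{1,\dots,n\}$, with $x=x_t$ and $\mu_j,\Sigma_j,\gamma_j$ the values of $\mu_{\tau,j},\Sigma_{\tau,j},\gamma_{\tau,j}$ at $x_t$, $\eta_{i,t}^{(\tau)}$ is the optimal value (infimum, in the extended reals) of the second-order cone program in $\eta,\beta,t_j,\omega_j,\Omega_j,\varphi_{1,j},\varphi_{2,j},\phi_{1,j},\phi_{2,j}\in\mathbb{R}$, $j=1,\dots,M_\tau$: $$\begin{aligned} \min\ &\eta\\ \text{s.t. }&\varepsilon\beta+\sum_{j=1}^{M_\tau}\gamma_j\left\{t_j+\mu_j\omega_j+(\Sigma_j+\mu_j^2)\Omega_j\right\}\le 0,\\ &\left\|\begin{pmatrix}\omega_j+\varphi_{1,j}-\varphi_{2,j}\\ \Omega_j-t_j+\tilde w_2^{(\tau)}\varphi_{1,j}-\tilde w_1^{(\tau)}\varphi_{2,j}\end{pmatrix}\right\|_2\le\Omega_j+t_j-\tilde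 w_2^{(\tau)}\varphi_{1,j}+\tilde w_1^{(\tau)}\varphi_{2,j},\\ &\left\|\begin{pmatrix}\omega_j-(-1)^i+\phi_{1,j}-\phi_{2,j}\\ \Omega_j-t_j-\beta-\eta+\tilde w_2^{(\tau)}\phi_{1,j}-\tilde w_1^{(\tau)}\phi_{2,j}\end{pmatrix}\right\|_2\le\Omega_j+t_j+\beta+\eta-\tilde w_2^{(\tau)}\phi_{1,j}+\tilde w_1^{(\tau)}\phi_{2,j},\\ &\Omega_j,\varphi_{1,j},\varphi_{2,j},\phi_{1,j},\phi_{2,j}\ge0,\qquad\forall j. \end{aligned}$$ Problem $\mathscr{P}_{MoDR}(x_t)$: with $Q,R,P$ positive definite weight matrices ($P$ determined by the Riccati equation), $$\begin{aligned} \min_{s_{0|t},\,v_{0|t},\dots,v_{N-1|t}}\ &\sum_{k=0}^{N-1}\left(\|s_{k|t}\|_Q^2+\|v_{k|t}\|_R^2\right)+\|s_{N|t}\|_P^2\\ \text{s.t. }&x_t-s_{0|t}\in\mathcal{Z},\\ &s_{k+1|t}=As_{k|t}+Bv_{k|t},\quad k=0,\dots,N-1,\\ &s_{1|t}+(A+BK)(x_t-s_{0|t})\in[\tilde x_1+\eta_{1,t},\ \tilde x_2-\eta_{2,t}],\\ &s_{k|t}\in\mathbb{X}\ominus\mathcal{Z},\quad k=2,\dots,N-1,\\ &v_{k|t}\in\mathbb{U}\ominus K\mathcal{Z},\quad k=0,\dots,N-1,\\ &s_{N|t}\in\mathcal{X}_f. \end{aligned}$$ $\mathscr{P}_{MoDR}(x_{t+1})$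 is the same problem with $x_t$ replaced by $x_{t+1}$ everywhere, including in the tightening parameters $\eta_{i,t+1}$. *)

theory Defs
  imports "HOL-Analysis.Analysis"
begin

definition schur_stable :: "real^'n^'n \<Rightarrow> bool" where
  "schur_stable F \<longleftrightarrow>
     (\<forall>(l::complex) (v::complex^'n). v \<noteq> 0 \<and> map_matrix complex_of_real F *v v = l *s v
        \<longrightarrow> cmod l < 1)"

definition stabilizable :: "real^'n^'n \<Rightarrow> real^'m^'n \<Rightarrow> bool" where
  "stabilizable A B \<longleftrightarrow> (\<exists>F :: real^'n^'m. schur_stable (A + B ** F))"

definition pos_def :: "real^'n^'n \<Rightarrow> bool" where
  "pos_def M \<longleftrightarrow> transpose M = M \<and> (\<forall>x. x \<noteq> 0 \<longrightarrow> 0 < x \<bullet> (M *v x))"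

definition wnorm2 :: "real^'n^'n \<Rightarrow> real^'n \<Rightarrow> real" where
  "wnorm2 M x = x \<bullet> (M *v x)"

text \<open>Discrete-time algebraic Riccati equation for the weights \<open>Q\<close>, \<open>R\<close>.\<close>

definition riccati ::
  "real^'n^'n \<Rightarrow> real^'m^'n \<Rightarrow> real^'n^'n \<Rightarrow> real^'m^'m \<Rightarrow> real^'n^'n \<Rightarrow> bool" where
  "riccati A B Q R P \<longleftrightarrow>
     P = transpose A ** P ** A
       - transpose A ** P ** B ** matrix_inv (R + transpose B ** P ** B) ** transpose B ** P ** A
       + Q"

definition pontryagin_diff :: "'a::plus set \<Rightarrow> 'a set \<Rightarrow> 'a set"  (infixl "\<ominus>" 65) where
  "S \<ominus> T = {a. \<forall>b\<in>T. a + b \<in> S}"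

definition polyhedron_ineq :: "real^'m^'p \<Rightarrow> real^'p \<Rightarrow> (real^'m) set" where
  "polyhedron_ineq H h = {u. H *v u \<le> h}"

text \<open>Here \<open>+\<close> on sets is the Minkowski sum.\<close>

definition robust_pos_inv :: "real^'n^'n \<Rightarrow> (real^'n) set \<Rightarrow> (real^'n) set \<Rightarrow> bool" where
  "robust_pos_inv F W Z \<longleftrightarrow> Z \<noteq> {} \<and> compact Z \<and> (*v) F ` Z + W \<subseteq> Z"

definition minimal_rpi :: "real^'n^'n \<Rightarrow> (real^'n) set \<Rightarrow> (real^'n) set \<Rightarrow> bool" where
  "minimal_rpi F W Z \<longleftrightarrow>
     robust_pos_inv F W Z \<and> (\<forall>Z'. robust_pos_inv F W Z' \<longrightarrow> Z \<subseteq> Z')"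

definition terminal_set ::
  "real^'n^'n \<Rightarrow> real^'m^'n \<Rightarrow> real^'n^'m \<Rightarrow> (real^'n) set \<Rightarrow> (real^'m) set \<Rightarrow> (real^'n) set
     \<Rightarrow> (real^'n) set" where
  "terminal_set A B K X U Z =
     {s. \<forall>i::nat. ((*v) (A + B ** K) ^^ i) s \<in> X \<ominus> Z
                \<and> K *v (((*v) (A + B ** K) ^^ i) s) \<in> U \<ominus> (*v) K ` Z}"

text \<open>A finite scalar mixture; its components are indexed by \<open>1, \<dots>, components\<close>,
  and the values of the remaining fields outside this range are irrelevant.\<close>

record mixture =
  components :: nat
  mean :: "nat \<Rightarrow> real"
  variance :: "nat \<Rightarrow> real"
  weight :: "nat \<Rightarrow> real"

definition valid_mixture :: "mixture \<Rightarrow> bool" where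
  "valid_mixture m \<longleftrightarrow>
     (\<forall>j\<in>{1..components m}. 0 \<le> variance m j \<and> 0 < weight m j)
     \<and> (\<Sum>j=1..components m. weight m j) = 1"

text \<open>Constraints of the second-order cone program for \<open>\<eta>\<close> on the disturbance interval \<open>[l, u]\<close>.
  The norm on \<open>real \<times> real\<close> is the Euclidean one.\<close>

definition socp_feasible :: "real \<Rightarrow> real \<Rightarrow> real \<Rightarrow> mixture \<Rightarrow> nat \<Rightarrow> real \<Rightarrow> bool" where
  "socp_feasible \<epsilon> l u m i \<eta> \<longleftrightarrow>
     (\<exists>(\<beta>::real) (t::nat \<Rightarrow> real) (\<omega>::nat \<Rightarrow> real) (\<Omega>::nat \<Rightarrow> real)
        (\<phi>1::nat \<Rightarrow> real) (\<phi>2::nat \<Rightarrow> real) (\<psi>1::nat \<Rightarrow> real) (\<psi>2::nat \<Rightarrow> real).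
        \<epsilon> * \<beta> + (\<Sum>j=1..components m. weight m j *
            (t j + mean m j * \<omega> j + (variance m j + (mean m j)\<^sup>2) * \<Omega> j)) \<le> 0
      \<and> (\<forall>j\<in>{1..components m}.
            norm (\<omega> j + \<phi>1 j - \<phi>2 j, \<Omega> j - t j + u * \<phi>1 j - l * \<phi>2 j)
              \<le> \<Omega> j + t j - u * \<phi>1 j + l * \<phi>2 j
          \<and> norm (\<omega> j - (-1) ^ i + \<psi>1 j - \<psi>2 j,
                  \<Omega> j - t j - \<beta> - \<eta> + u * \<psi>1 j - l * \<psi>2 j)
              \<le> \<Omega> j + t j + \<beta> + \<eta> - u * \<psi>1 j + l * \<psi>2 j
          \<and> 0 \<le> \<Omega> j \<and> 0 \<le> \<phi>1 j \<and> 0 \<le> \<phi>2 j \<and> 0 \<le> \<psi>1 j \<and> 0 \<le> \<psi>2 j))"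

definition tightening ::
  "real \<Rightarrow> real^'n \<Rightarrow> real^'n \<Rightarrow> ('n \<Rightarrow> real^'n \<Rightarrow> mixture) \<Rightarrow> nat \<Rightarrow> real^'n \<Rightarrow> 'n \<Rightarrow> ereal" where
  "tightening \<epsilon> w1 w2 mix i x \<tau> =
     Inf {ereal \<eta> | \<eta>. socp_feasible \<epsilon> (w1 $ \<tau>) (w2 $ \<tau>) (mix \<tau> x) i \<eta>}"

text \<open>The nominal trajectory generated by \<open>s\<^sub>0\<close> and an input sequence. An input sequence of
  length \<open>N\<close> is a function on \<open>nat\<close> of which only the values below \<open>N\<close> matter.\<close>

primrec nominal :: "real^'n^'n \<Rightarrow> real^'m^'n \<Rightarrow> real^'n \<Rightarrow> (nat \<Rightarrow> real^'m) \<Rightarrow> nat \<Rightarrow> real^'n" where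
  "nominal A B s0 v 0 = s0"
| "nominal A B s0 v (Suc k) = A *v nominal A B s0 v k + B *v v k"

text \<open>\<open>(s0, v)\<close> satisfies the constraints of the problem at the measured state \<open>x\<close>. The argument
  \<open>\<eta> i x\<close> is the tightening vector; the box constraint is stated in \<open>ereal\<close>, as an optimal value
  of the cone program may be infinite.\<close>

definition modr_feasible ::
  "real^'n^'n \<Rightarrow> real^'m^'n \<Rightarrow> real^'n^'m \<Rightarrow> real^'n \<Rightarrow> real^'n \<Rightarrow> (real^'m) set \<Rightarrow> (real^'n) set
     \<Rightarrow> nat \<Rightarrow> (nat \<Rightarrow> real^'n \<Rightarrow> 'n \<Rightarrow> ereal) \<Rightarrow> real^'n \<Rightarrow> real^'n \<Rightarrow> (nat \<Rightarrow> real^'m) \<Rightarrow> bool" where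
  "modr_feasible A B K x1 x2 U Z N \<eta> x s0 v \<longleftrightarrow>
     x - s0 \<in> Z
   \<and> (\<forall>\<tau>. let y = (nominal A B s0 v 1 + (A + B ** K) *v (x - s0)) $ \<tau>
          in ereal (x1 $ \<tau>) + \<eta> 1 x \<tau> \<le> ereal y \<and> ereal y \<le> ereal (x2 $ \<tau>) - \<eta> 2 x \<tau>)
   \<and> (\<forall>k. 2 \<le> k \<and> k < N \<longrightarrow> nominal A B s0 v k \<in> {x1..x2} \<ominus> Z)
   \<and> (\<forall>k<N. v k \<in> U \<ominus> (*v) K ` Z)
   \<and> nominal A B s0 v N \<in> terminal_set A B K {x1..x2} U Z"

definition modr_cost ::
  "real^'n^'n \<Rightarrow> real^'m^'n \<Rightarrow> nat \<Rightarrow> real^'n^'n \<Rightarrow> real^'m^'m \<Rightarrow> real^'n^'n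
     \<Rightarrow> real^'n \<Rightarrow> (nat \<Rightarrow> real^'m) \<Rightarrow> real" where
  "modr_cost A B N Q R P s0 v =
     (\<Sum>k<N. wnorm2 Q (nominal A B s0 v k) + wnorm2 R (v k)) + wnorm2 P (nominal A B s0 v N)"

definition modr_problem_feasible ::
  "real^'n^'n \<Rightarrow> real^'m^'n \<Rightarrow> real^'n^'m \<Rightarrow> real^'n \<Rightarrow> real^'n \<Rightarrow> (real^'m) set \<Rightarrow> (real^'n) set
     \<Rightarrow> nat \<Rightarrow> (nat \<Rightarrow> real^'n \<Rightarrow> 'n \<Rightarrow> ereal) \<Rightarrow> real^'n \<Rightarrow> bool" where
  "modr_problem_feasible A B K x1 x2 U Z N \<eta> x \<longleftrightarrow>
     (\<exists>s0 v. modr_feasible A B K x1 x2 U Z N \<eta> x s0 v)"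

definition modr_optimal ::
  "real^'n^'n \<Rightarrow> real^'m^'n \<Rightarrow> real^'n^'m \<Rightarrow> real^'n \<Rightarrow> real^'n \<Rightarrow> (real^'m) set \<Rightarrow> (real^'n) set
     \<Rightarrow> nat \<Rightarrow> (nat \<Rightarrow> real^'n \<Rightarrow> 'n \<Rightarrow> ereal) \<Rightarrow> real^'n^'n \<Rightarrow> real^'m^'m \<Rightarrow> real^'n^'n
     \<Rightarrow> real^'n \<Rightarrow> real^'n \<Rightarrow> (nat \<Rightarrow> real^'m) \<Rightarrow> bool" where
  "modr_optimal A B K x1 x2 U Z N \<eta> Q R P x s0 v \<longleftrightarrow>
     modr_feasible A B K x1 x2 U Z N \<eta> x s0 v
   \<and> (\<forall>s0' v'. modr_feasible A B K x1 x2 U Z N \<eta> x s0' v'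
        \<longrightarrow> modr_cost A B N Q R P s0 v \<le> modr_cost A B N Q R P s0' v')"

end

theory Submission
  imports Defs
begin

text \<open>Shift the optimal solution by one step and append the terminal input \<open>K s\<^sub>N\<close>. Each
  tightening parameter is at most the worst-case bound of the box, \<open>-w\<^sub>1\<close> or \<open>w\<^sub>2\<close>, whatever the
  mixture at the new state is, so the tightened box contains every \<open>y\<close> with \<open>y + W \<subseteq> X\<close>; the point
  \<open>y = s\<^sub>2 + (A + BK) e\<close>, with \<open>e\<close> in \<open>Z\<close> the new error, is of this kind because \<open>s\<^sub>2\<close> lies in
  \<open>X \<ominus> Z\<close> and \<open>Z\<close> is robustly invariant.\<close>

text \<open>The certificate is the dual proof of the worst-case bound: \<open>- w \<le> - l\<close>
  on \<open>[l, u]\<close> is the constraint \<open>w \<ge> l\<close> taken with multiplier 1, and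
  no moment information enters.\<close>

lemma tightening_1_le: "tightening \<epsilon> w1 w2 mix 1 x \<tau> \<le> ereal (- (w1 $ \<tau>))"
proof -
  have "socp_feasible \<epsilon> (w1 $ \<tau>) (w2 $ \<tau>) (mix \<tau> x) 1 (- (w1 $ \<tau>))"
    unfolding socp_feasible_def
    \<comment> \<open>Only \<open>\<psi>2\<close> is nonzero. It cancels \<open>(-1) ^ 1\<close> in
      the second cone constraint and \<open>\<eta>\<close> against the lower end of the interval,
      leaving \<open>0 \<le> 0\<close>.\<close>
    by (rule exI[of _ 0], rule exI[of _ "\<lambda>_. 0"], rule exI[of _ "\<lambda>_. 0"], rule exI[of _ "\<lambda>_. 0"],
        rule exI[of _ "\<lambda>_. 0"], rule exI[of _ "\<lambda>_. 0"], rule exI[of _ "\<lambda>_. 0"],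
        rule exI[of _ "\<lambda>_. 1"]) simp
  then show ?thesis
    unfolding tightening_def by (intro Inf_lower) blast
qed

lemma tightening_2_le: "tightening \<epsilon> w1 w2 mix 2 x \<tau> \<le> ereal (w2 $ \<tau>)"
proof -
  have "socp_feasible \<epsilon> (w1 $ \<tau>) (w2 $ \<tau>) (mix \<tau> x) 2 (w2 $ \<tau>)"
    unfolding socp_feasible_def
    \<comment> \<open>By symmetry the multiplier is now \<open>\<psi>1\<close>, which belongs to the
      upper end of the interval.\<close>
    by (rule exI[of _ 0], rule exI[of _ "\<lambda>_. 0"], rule exI[of _ "\<lambda>_. 0"], rule exI[of _ "\<lambda>_. 0"],
        rule exI[of _ "\<lambda>_. 0"], rule exI[of _ "\<lambda>_. 0"], rule exI[of _ "\<lambda>_. 1"],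
        rule exI[of _ "\<lambda>_. 0"]) simp
  then show ?thesis
    unfolding tightening_def by (intro Inf_lower) blast
qed

text \<open>Two corners of the disturbance box suffice: \<open>y + w1\<close> tests the lower bounds
  and \<open>y + w2\<close> the upper ones. The real bounds above exclude a tightening of plus
  infinity, and minus infinity only widens the box.\<close>

lemma tightened_box:
  assumes "w1 \<le> w2" and "\<And>w. w \<in> {w1..w2} \<Longrightarrow> y + w \<in> {x1..x2}"
  shows "ereal (x1 $ \<tau>) + tightening \<epsilon> w1 w2 mix 1 x \<tau> \<le> ereal (y $ \<tau>)"
    and "ereal (y $ \<tau>) \<le> ereal (x2 $ \<tau>) - tightening \<epsilon> w1 w2 mix 2 x \<tau>"
proof -
  have "y + w1 \<in> {x1..x2}" "y + w2 \<in> {x1..x2}"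
    using assms by simp_all
  then have *: "x1 $ \<tau> \<le> y $ \<tau> + w1 $ \<tau>" "y $ \<tau> + w2 $ \<tau> \<le> x2 $ \<tau>"
    by (simp_all add: less_eq_vec_def)
  have "ereal (x1 $ \<tau>) + tightening \<epsilon> w1 w2 mix 1 x \<tau> \<le> ereal (x1 $ \<tau>) + ereal (- (w1 $ \<tau>))"
    by (intro add_left_mono tightening_1_le)
  also have "\<dots> \<le> ereal (y $ \<tau>)"
    using * by simp
  finally show "ereal (x1 $ \<tau>) + tightening \<epsilon> w1 w2 mix 1 x \<tau> \<le> ereal (y $ \<tau>)" .
  have "ereal (y $ \<tau>) \<le> ereal (x2 $ \<tau>) - ereal (w2 $ \<tau>)"
    using * by simp
  also have "\<dots> \<le> ereal (x2 $ \<tau>) - tightening \<epsilon> w1 w2 mix 2 x \<tau>"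
    by (intro ereal_minus_mono tightening_2_le order_refl)
  finally show "ereal (y $ \<tau>) \<le> ereal (x2 $ \<tau>) - tightening \<epsilon> w1 w2 mix 2 x \<tau>" .
qed

lemma robust_pos_invD:
  assumes "robust_pos_inv F W Z" and "e \<in> Z" and "w \<in> W"
  shows "F *v e + w \<in> Z"
  using assms unfolding robust_pos_inv_def by (blast intro: set_plus_intro)

lemma terminal_setD:
  assumes "s \<in> terminal_set A B K X U Z"
  shows "s \<in> X \<ominus> Z" and "K *v s \<in> U \<ominus> (*v) K ` Z"
    and "(A + B ** K) *v s \<in> terminal_set A B K X U Z"
proof -
  have *: "((*v) (A + B ** K) ^^ i) s \<in> X \<ominus> Z \<and> K *v (((*v) (A + B ** K) ^^ i) s) \<in> U \<ominus> (*v) K ` Z"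
    for i
    using assms unfolding terminal_set_def by blast
  from *[of 0] show "s \<in> X \<ominus> Z" "K *v s \<in> U \<ominus> (*v) K ` Z"
    by simp_all
  \<comment> \<open>The orbit of the image point is the orbit of \<open>s\<close> without its first
    term.\<close>
  from *[of "Suc i" for i] show "(A + B ** K) *v s \<in> terminal_set A B K X U Z"
    by (simp add: terminal_set_def funpow_swap1)
qed

lemma closed_loop: "A *v s + B *v (K *v s) = (A + B ** K) *v s"
  by (simp add: matrix_vector_mult_add_rdistrib matrix_vector_mul_assoc)

text \<open>The second branch matters only at \<open>k = N - 1\<close>, since the problem reads no
  input from index \<open>N\<close> on.\<close>

definition shifted_inputs ::
  "real^'n^'n \<Rightarrow> real^'m^'n \<Rightarrow> real^'n^'m \<Rightarrow> nat \<Rightarrow> real^'n \<Rightarrow> (nat \<Rightarrow> real^'m) \<Rightarrow> nat \<Rightarrow> real^'m" where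
  "shifted_inputs A B K N s0 v k = (if Suc k < N then v (Suc k) else K *v nominal A B s0 v N)"

text \<open>The appended input acts first in the step from \<open>N - 1\<close> to \<open>N\<close>,
  so before that step the new trajectory is the old one read one index ahead, ending in the old
  terminal state.\<close>

lemma nominal_shifted_less:
  "k < N \<Longrightarrow> nominal A B (nominal A B s0 v 1) (shifted_inputs A B K N s0 v) k
     = nominal A B s0 v (Suc k)"
  by (induction k) (simp_all add: shifted_inputs_def)

lemma nominal_shifted_horizon:
  assumes "0 < N"
  shows "nominal A B (nominal A B s0 v 1) (shifted_inputs A B K N s0 v) N
    = (A + B ** K) *v nominal A B s0 v N"
proof -
  obtain n where N: "N = Suc n"
    using assms gr0_implies_Suc by blast
  have "nominal A B (nominal A B s0 v 1) (shifted_inputs A B K N s0 v) n = nominal A B s0 v N"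
    using nominal_shifted_less[of n N] by (simp add: N)
  then have "nominal A B (nominal A B s0 v 1) (shifted_inputs A B K N s0 v) N
    = A *v nominal A B s0 v N + B *v shifted_inputs A B K N s0 v n"
    by (simp only: N nominal.simps)
  also have "shifted_inputs A B K N s0 v n = K *v nominal A B s0 v N"
    by (simp add: shifted_inputs_def N)
  finally show ?thesis
    by (simp only: closed_loop)
qed

lemma modr_feasible_shifted:
  assumes N: "0 < N" and rpi: "robust_pos_inv (A + B ** K) {w1..w2} Z"
    and feas: "modr_feasible A B K x1 x2 U Z N \<eta> x s0 v" and w: "w \<in> {w1..w2}"
    and x': "x' = A *v x + B *v (K *v (x - s0) + v 0) + w"
  shows "modr_feasible A B K x1 x2 U Z N (tightening \<epsilon> w1 w2 mix) x'
    (nominal A B s0 v 1) (shifted_inputs A B K N s0 v)"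
proof -
  let ?F = "A + B ** K" and ?s = "nominal A B s0 v" and ?v' = "shifted_inputs A B K N s0 v"
  let ?s' = "nominal A B (?s 1) ?v'"
  have e0: "x - s0 \<in> Z" and state: "\<And>k. 2 \<le> k \<Longrightarrow> k < N \<Longrightarrow> ?s k \<in> {x1..x2} \<ominus> Z"
    and input: "\<And>k. k < N \<Longrightarrow> v k \<in> U \<ominus> (*v) K ` Z"
    and final: "?s N \<in> terminal_set A B K {x1..x2} U Z"
    using feas unfolding modr_feasible_def by blast+
  \<comment> \<open>The feedforward term \<open>B *v v 0\<close> occurs in both \<open>x'\<close>
    and \<open>?s 1\<close> and cancels, which leaves the error dynamics.\<close>
  have "x' - ?s 1 = ?F *v (x - s0) + w"
    unfolding x' closed_loop[symmetric] by (simp add: algebra_simps)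
  then have e1: "x' - ?s 1 \<in> Z"
    using robust_pos_invD[OF rpi e0 w] by simp
  \<comment> \<open>The range includes \<open>k = N\<close> so that \<open>k = 1\<close> is covered
    even for a horizon of one, where \<open>?s' 1\<close> is already the image of the old terminal
    state. From \<open>1 \<le> k\<close> the shifted index is at least 2, where the old state
    constraints begin.\<close>
  have state': "?s' k \<in> {x1..x2} \<ominus> Z" if "1 \<le> k" "k \<le> N" for k
  proof -
    consider "Suc k < N" | "Suc k = N" | "k = N"
      using \<open>k \<le> N\<close> by linarith
    then show ?thesis
    proof cases
      case 1
      then show ?thesis
        using state[of "Suc k"] that by (simp add: nominal_shifted_less del: nominal.simps One_nat_def)
    next
      case 2
      then show ?thesis
        using terminal_setD(1)[OF final]
        by (simp add: nominal_shifted_less del: nominal.simps One_nat_def)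
    next
      case 3
      then show ?thesis
        using terminal_setD(1)[OF terminal_setD(3)[OF final]] by (simp only: nominal_shifted_horizon[OF N])
    qed
  qed
  have box: "?s' 1 + ?F *v (x' - ?s 1) + w' \<in> {x1..x2}" if "w' \<in> {w1..w2}" for w'
    using state'[of 1] N robust_pos_invD[OF rpi e1 that]
    unfolding pontryagin_diff_def by (auto simp: add.assoc simp del: nominal.simps)
  \<comment> \<open>The realised disturbance shows that the box is nonempty, so its corners belong
    to it.\<close>
  have "w1 \<le> w2"
    using w by auto
  note tight = tightened_box[OF this box]
  have input': "?v' k \<in> U \<ominus> (*v) K ` Z" if "k < N" for k
    using that input terminal_setD(2)[OF final] by (simp add: shifted_inputs_def)
  have "?s' N \<in> terminal_set A B K {x1..x2} U Z"
    using terminal_setD(3)[OF final] by (simp only: nominal_shifted_horizon[OF N])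
  then show ?thesis
    unfolding modr_feasible_def Let_def using e1 tight state' input'
    by (metis One_nat_def Suc_1 Suc_leD less_imp_le)
qed

theorem theorem2:
  fixes A Q P :: "real^'n^'n" and B :: "real^'m^'n" and K :: "real^'n^'m" and R :: "real^'m^'m"
    and w1 w2 x1 x2 :: "real^'n" and H :: "real^'m^'p" and h :: "real^'p"
    and Z :: "(real^'n) set" and \<epsilon> :: real and N :: nat
    and mix :: "'n \<Rightarrow> real^'n \<Rightarrow> mixture"
    and xt s0 :: "real^'n" and v :: "nat \<Rightarrow> real^'m" and u :: "real^'m"
  assumes "stabilizable A B"
    and "schur_stable (A + B ** K)"
    and "compact {x1..x2}" and "0 \<in> interior {x1..x2}"
    and "compact (polyhedron_ineq H h)" and "0 \<in> interior (polyhedron_ineq H h)"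
    and "0 < \<epsilon>" and "\<epsilon> < 1" and "0 < N"
    and "minimal_rpi (A + B ** K) {w1..w2} Z"
    and "\<forall>\<tau> x. valid_mixture (mix \<tau> x)"
    and "pos_def Q" and "pos_def R" and "pos_def P" and "riccati A B Q R P"
    and "modr_problem_feasible A B K x1 x2 (polyhedron_ineq H h) Z N
           (tightening \<epsilon> w1 w2 mix) xt"
    and "modr_optimal A B K x1 x2 (polyhedron_ineq H h) Z N
           (tightening \<epsilon> w1 w2 mix) Q R P xt s0 v"
    and "u = K *v (xt - s0) + v 0"
  shows "\<forall>w\<in>{w1..w2}. modr_problem_feasible A B K x1 x2 (polyhedron_ineq H h) Z N
           (tightening \<epsilon> w1 w2 mix) (A *v xt + B *v u + w)"
proof
  fix w assume w: "w \<in> {w1..w2}"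
  have rpi: "robust_pos_inv (A + B ** K) {w1..w2} Z"
    using assms(10) by (simp add: minimal_rpi_def)
  have "modr_feasible A B K x1 x2 (polyhedron_ineq H h) Z N (tightening \<epsilon> w1 w2 mix) xt s0 v"
    using assms(17) by (simp add: modr_optimal_def)
  from modr_feasible_shifted[OF \<open>0 < N\<close> rpi this w refl]
  show "modr_problem_feasible A B K x1 x2 (polyhedron_ineq H h) Z N
          (tightening \<epsilon> w1 w2 mix) (A *v xt + B *v u + w)"
    unfolding modr_problem_feasible_def \<open>u = K *v (xt - s0) + v 0\<close> by blast
qed

end
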